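(* Let $(\lambda_n)_{n\ge1}$ be a strictly increasing sequence of positive real numbers with $\lambda_n\to\infty$, let $\phi(x,y)$ be any complex-valued function of two variables, and let $x_1,x_2\ge0$ be real. Then $$\sum_{\lambda_m\le x_1}\sum_{\lambda_n\le x_2}\phi(\lambda_m,\lambda_n)=\mathop{\sum\sum}_{\lambda_m\lambda_n\le x_1x_2}\phi(\lambda_m,\lambda_n)-\sum_{\lambda_m\le x_1}\ \sum_{x_2<\lambda_n\le x_1x_2/\lambda_m}\phi(\lambda_m,\lambda_n)-\sum_{\lambda_n\le x_2}\ \sum_{x_1<\lambda_m\le x_1x_2/\lambda_n}\phi(\lambda_m,\lambda_n).$$
   Context: Sums run over indices $m,n\ge1$ satisfying the displayed conditions; empty sums are zero. *)

theory Defs imports Complex_Main begin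

end

theory Submission imports Defs begin

text \<open>
  Since \<open>\<lambda>\<^sub>m > x\<^sub>1\<close> and \<open>\<lambda>\<^sub>n > x\<^sub>2\<close> together force \<open>\<lambda>\<^sub>m \<lambda>\<^sub>n > x\<^sub>1 x\<^sub>2\<close>, the region under the
  hyperbola is the disjoint union of the box and the two tails beyond its sides.
\<close>

text \<open>A property that holds eventually along \<open>sequentially\<close> fails at only
  finitely many naturals. Applied to \<open>l\<close>, this makes the index sets finite, so no sum
  takes the default value 0 of an infinite one.\<close>

lemma finite_le_if_filterlim_at_top:
  fixes f :: "nat \<Rightarrow> real"
  assumes "filterlim f at_top sequentially"
  shows "finite {n. f n \<le> c}"
proof -
  from assms have "eventually (\<lambda>n. c < f n) sequentially"
    by (simp add: filterlim_at_top_dense)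
  then show ?thesis
    by (simp add: eventually_cofinite not_less flip: cofinite_eq_sequentially)
qed

theorem mainTheorem2:
  fixes l :: "nat \<Rightarrow> real"
    and \<phi> :: "real \<Rightarrow> real \<Rightarrow> complex"
    and x1 x2 :: real
  assumes "strict_mono_on {1..} l"
    and "\<And>n. n \<ge> 1 \<Longrightarrow> l n > 0"
    and "filterlim l at_top sequentially"
    and "x1 \<ge> 0" and "x2 \<ge> 0"
  shows "(\<Sum>m | 1 \<le> m \<and> l m \<le> x1. \<Sum>n | 1 \<le> n \<and> l n \<le> x2. \<phi> (l m) (l n)) =
    (\<Sum>(m, n) \<in> {(m, n). 1 \<le> m \<and> 1 \<le> n \<and> l m * l n \<le> x1 * x2}. \<phi> (l m) (l n))
    - (\<Sum>m | 1 \<le> m \<and> l m \<le> x1.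
        \<Sum>n | 1 \<le> n \<and> x2 < l n \<and> l n \<le> x1 * x2 / l m. \<phi> (l m) (l n))
    - (\<Sum>n | 1 \<le> n \<and> l n \<le> x2.
        \<Sum>m | 1 \<le> m \<and> x1 < l m \<and> l m \<le> x1 * x2 / l n. \<phi> (l m) (l n))"
proof -
  define f where "f = (\<lambda>(m, n). \<phi> (l m) (l n))"
  define M where "M = {m. 1 \<le> m \<and> l m \<le> x1}"
  define N where "N = {n. 1 \<le> n \<and> l n \<le> x2}"
  define V where "V m = {n. 1 \<le> n \<and> x2 < l n \<and> l n \<le> x1 * x2 / l m}" for m
  define H where "H n = {m. 1 \<le> m \<and> x1 < l m \<and> l m \<le> x1 * x2 / l n}" for n
  define D where "D = {(m, n). 1 \<le> m \<and> 1 \<le> n \<and> l m * l n \<le> x1 * x2}"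
  \<comment> \<open>The last double sum runs over \<open>n\<close> first; the swap turns its pairs
    into the order \<open>(m, n)\<close> used in \<open>D\<close>.\<close>
  define R where "R = prod.swap ` Sigma N H"
  have fin: "finite {n. l n \<le> c}" for c
    using assms(3) by (rule finite_le_if_filterlim_at_top)
  have finite: "finite M" "finite N" "finite (V m)" "finite (H n)" for m n
    unfolding M_def N_def V_def H_def by (rule finite_subset[OF _ fin]; blast)+
  have R_iff: "(m, n) \<in> R \<longleftrightarrow> n \<in> N \<and> m \<in> H n" for m n
    by (force simp: R_def)
  \<comment> \<open>Positivity of \<open>l\<close> is known only from index 1 on; pairs with an
    index 0 lie in neither side.\<close>
  have D_iff: "(m, n) \<in> D \<longleftrightarrow> (m, n) \<in> M \<times> N \<union> Sigma M V \<union> R" for m n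
  proof (cases "1 \<le> m \<and> 1 \<le> n")
    case True
    then have pos: "0 < l m" "0 < l n"
      using assms(2) by auto
    have "l m * l n \<le> x1 * x2" if "l m \<le> x1" "l n \<le> x2"
      using that pos assms(4) by (intro mult_mono) auto
    moreover have "l m \<le> x1 \<or> l n \<le> x2" if "l m * l n \<le> x1 * x2"
      using that assms(4,5) mult_strict_mono'[of x1 "l m" x2 "l n"] by linarith
    \<comment> \<open>Dividing by the positive \<open>l m\<close> or \<open>l n\<close> turns the
      product bound into the upper limit of a tail.\<close>
    ultimately show ?thesis
      using True pos
      by (auto simp: D_def R_iff M_def N_def V_def H_def pos_le_divide_eq mult.commute)
  qed (auto simp: D_def R_iff M_def N_def V_def H_def)
  have D_eq: "D = M \<times> N \<union> Sigma M V \<union> R"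
    using D_iff by auto
  \<comment> \<open>Disjointness: \<open>x1 < l m\<close> on \<open>R\<close>, but
    \<open>l m \<le> x1\<close> on the rest. The next split separates in the same way by comparing
    \<open>l n\<close> with \<open>x2\<close>.\<close>
  have "sum f D = sum f (M \<times> N \<union> Sigma M V) + sum f R"
    unfolding D_eq using finite
    by (intro sum.union_disjoint) (auto simp: R_def M_def N_def V_def H_def)
  also have "sum f (M \<times> N \<union> Sigma M V) = sum f (M \<times> N) + sum f (Sigma M V)"
    using finite by (intro sum.union_disjoint) (auto simp: N_def V_def)
  also have "sum f R = sum (\<lambda>(n, m). \<phi> (l m) (l n)) (Sigma N H)"
    unfolding R_def by (subst sum.reindex) (auto simp: f_def intro!: sum.cong)
  finally have "(\<Sum>m\<in>M. \<Sum>n\<in>N. \<phi> (l m) (l n)) =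
      sum f D - (\<Sum>m\<in>M. \<Sum>n\<in>V m. \<phi> (l m) (l n)) - (\<Sum>n\<in>N. \<Sum>m\<in>H n. \<phi> (l m) (l n))"
    using finite by (simp add: sum.Sigma f_def)
  then show ?thesis
    by (simp only: f_def M_def N_def V_def H_def D_def)
qed

end
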